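(* Let $g_1,g_2:[0,1]\to\mathbb{R}$ be absolutely continuous with $g_k(0)=g_k(1)=0$ and essentially bounded a.e. derivatives $g_k'\in L^\infty([0,1])$, $k\in\{1,2\}$, and let $a\in\mathbb{R}$ be such that $$C(u_1,u_2)=u_1u_2+a\,g_1(u_1)g_2(u_2),\qquad (u_1,u_2)\in[0,1]^2,$$ is a copula. Then Spearman's rho of $C$ satisfies $$-\frac34\le\rho_S(C)\le\frac34.$$ The bounds are sharp, that is, neither constant can be improved over the class of all such copulas $C$ (over all admissible $g_1,g_2,a$).
   Context: A copula on $[0,1]^2$ is a bivariate distribution function with uniform univariate margins on $[0,1]$. Spearman's rho of a bivariate copula $C$ is $\rho_S(C)=12\int_{[0,1]^2}u_1u_2\,dC(u_1,u_2)-3=12\int_{[0,1]^2}\left(C(u_1,u_2)-u_1u_2\right)du_1\,du_2$. *)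

theory Defs
  imports "HOL-Probability.Probability"
begin

subsection \<open>Copulas and Spearman's rho\<close>

text \<open>
  A copula is represented by a function on all of \<open>real \<times> real\<close>, of which only the values
  on the unit square are constrained or used. \<open>copula_measure C M\<close> says that \<open>M\<close> is the law
  of a pair with uniform margins on \<open>[0,1]\<close> whose joint distribution function on the unit
  square is \<open>C\<close>; the margins force \<open>M\<close> to be concentrated on the unit square.
\<close>

definition copula_measure :: "(real \<Rightarrow> real \<Rightarrow> real) \<Rightarrow> (real \<times> real) measure \<Rightarrow> bool" where
  "copula_measure C M \<longleftrightarrow>
     prob_space M \<and> sets M = sets borel \<and>
     distr M borel fst = uniform_measure lborel {0..1} \<and>
     distr M borel snd = uniform_measure lborel {0..1} \<and>
     (\<forall>u\<in>{0..1}. \<forall>v\<in>{0..1}. C u v = measure M ({..u} \<times> {..v}))"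

definition copula :: "(real \<Rightarrow> real \<Rightarrow> real) \<Rightarrow> bool" where
  "copula C \<longleftrightarrow> (\<exists>M. copula_measure C M)"

text \<open>The measure \<open>M\<close> is unique for a copula \<open>C\<close>, see \<open>copula_measure_unique\<close> below.\<close>

definition spearman_rho :: "(real \<Rightarrow> real \<Rightarrow> real) \<Rightarrow> real" where
  "spearman_rho C = 12 * (LINT p|(THE M. copula_measure C M). fst p * snd p) - 3"


subsection \<open>Absolutely continuous functions with essentially bounded derivative\<close>

definition absolutely_continuous_on_interval :: "real \<Rightarrow> real \<Rightarrow> (real \<Rightarrow> real) \<Rightarrow> bool" where
  "absolutely_continuous_on_interval a b f \<longleftrightarrow>
     (\<forall>\<epsilon>>0. \<exists>\<delta>>0. \<forall>(n::nat) x y.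
        (\<forall>i<n. a \<le> x i \<and> x i \<le> y i \<and> y i \<le> b) \<and>
        (\<forall>i<n. \<forall>j<n. i \<noteq> j \<longrightarrow> {x i<..<y i} \<inter> {x j<..<y j} = {}) \<and>
        (\<Sum>i<n. y i - x i) < \<delta>
        \<longrightarrow> (\<Sum>i<n. \<bar>f (y i) - f (x i)\<bar>) < \<epsilon>)"

definition essentially_bounded_on :: "real set \<Rightarrow> (real \<Rightarrow> real) \<Rightarrow> bool" where
  "essentially_bounded_on S h \<longleftrightarrow>
     h \<in> borel_measurable (lebesgue_on S) \<and> (\<exists>B. AE x in lebesgue_on S. \<bar>h x\<bar> \<le> B)"

definition admissible_factor :: "(real \<Rightarrow> real) \<Rightarrow> bool" where
  "admissible_factor g \<longleftrightarrow>
     absolutely_continuous_on_interval 0 1 g \<and> g 0 = 0 \<and> g 1 = 0 \<and>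
     (\<exists>g'. (AE x in lebesgue_on {0..1}. (g has_real_derivative g' x) (at x within {0..1})) \<and>
           essentially_bounded_on {0..1} g')"

definition product_perturbation ::
    "real \<Rightarrow> (real \<Rightarrow> real) \<Rightarrow> (real \<Rightarrow> real) \<Rightarrow> real \<Rightarrow> real \<Rightarrow> real" where
  "product_perturbation a g1 g2 = (\<lambda>u1 u2. u1 * u2 + a * g1 u1 * g2 u2)"


subsection \<open>Well-definedness of Spearman's rho\<close>

lemma copula_measure_AE:
  assumes "copula_measure C M"
  shows "AE p in M. 0 < fst p \<and> fst p \<le> 1 \<and> 0 < snd p \<and> snd p \<le> 1"
proof -
  have s[measurable_cong]: "sets M = sets borel"
    and d1: "distr M borel fst = uniform_measure lborel {0..1}"
    and d2: "distr M borel snd = uniform_measure lborel {0..1}"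
    using assms by (auto simp: copula_measure_def)
  have f: "fst \<in> borel_measurable M" and g: "snd \<in> borel_measurable M"
    using s by (simp_all add: borel_prod[symmetric] cong: measurable_cong_sets)
  have u: "AE x in uniform_measure lborel {0..1::real}. 0 < x \<and> x \<le> 1"
  proof (rule AE_uniform_measureI)
    have "AE x in lborel. x \<noteq> (0::real)" by (rule AE_lborel_singleton)
    then show "AE x in lborel. x \<in> {0..1} \<longrightarrow> 0 < x \<and> x \<le> (1::real)"
      by eventually_elim auto
  qed simp
  have "AE p in M. 0 < fst p \<and> fst p \<le> 1"
    using u unfolding d1[symmetric] by (subst (asm) AE_distr_iff[OF f]) auto
  moreover have "AE p in M. 0 < snd p \<and> snd p \<le> 1"
    using u unfolding d2[symmetric] by (subst (asm) AE_distr_iff[OF g]) auto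
  ultimately show ?thesis by eventually_elim auto
qed

lemma copula_measure_atMost:
  assumes "copula_measure C M"
  shows "emeasure M {..(a, b)} = ennreal (C (max 0 (min a 1)) (max 0 (min b 1)))"
proof -
  interpret prob_space M using assms by (simp add: copula_measure_def)
  have s: "sets M = sets borel" using assms by (simp add: copula_measure_def)
  let ?A = "{..max 0 (min a 1)} \<times> {..max 0 (min b 1)}"
  have A: "?A = {..(max 0 (min a 1), max 0 (min b 1))}" by auto
  have "emeasure M {..(a, b)} = emeasure M ?A"
  proof (rule emeasure_eq_AE)
    show "AE p in M. p \<in> {..(a, b)} \<longleftrightarrow> p \<in> ?A"
      using copula_measure_AE[OF assms] by eventually_elim (auto simp: less_eq_prod_def)
  qed (auto simp: s A)
  also have "\<dots> = ennreal (C (max 0 (min a 1)) (max 0 (min b 1)))"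
    using assms by (simp add: emeasure_eq_measure copula_measure_def)
  finally show ?thesis .
qed

lemma copula_measure_unique:
  assumes "copula_measure C M" "copula_measure C N"
  shows "M = N"
proof (rule measure_eqI_generator_eq
    [where E = "range (\<lambda>a::real \<times> real. {..a})" and \<Omega> = UNIV and A = "\<lambda>n. {..(real n, real n)}"])
  interpret prob_space M using assms by (simp add: copula_measure_def)
  show "Int_stable (range (\<lambda>a::real \<times> real. {..a}))"
  proof (rule Int_stableI)
    fix X Y :: "(real \<times> real) set"
    assume "X \<in> range (\<lambda>a. {..a})" "Y \<in> range (\<lambda>a. {..a})"
    then obtain a b where ab: "X = {..a}" "Y = {..b}" by auto
    have "{..a} \<inter> {..b} = {..(min (fst a) (fst b), min (snd a) (snd b))}"
      by (auto simp: less_eq_prod_def)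
    then show "X \<inter> Y \<in> range (\<lambda>a. {..a})" unfolding ab by auto
  qed
  have b: "sets borel = sigma_sets UNIV (range (\<lambda>a::real \<times> real. {..a}))"
    by (subst borel_eq_atMost) simp
  show "sets M = sigma_sets UNIV (range (\<lambda>a::real \<times> real. {..a}))"
    "sets N = sigma_sets UNIV (range (\<lambda>a::real \<times> real. {..a}))"
    using assms b by (auto simp: copula_measure_def)
  show "emeasure M X = emeasure N X" if "X \<in> range (\<lambda>a::real \<times> real. {..a})" for X
    using that copula_measure_atMost[OF assms(1)] copula_measure_atMost[OF assms(2)] by auto
  show "(\<Union>n. {..(real n, real n)}) = UNIV"
  proof (safe; simp)
    fix x y :: real
    show "\<exists>n. x \<le> real n \<and> y \<le> real n"
      using real_arch_simple[of "max x y"] by auto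
  qed
  show "emeasure M {..(real n, real n)} \<noteq> \<infinity>" for n
    by simp
qed auto

lemma spearman_rho_eq:
  assumes "copula_measure C M"
  shows "spearman_rho C = 12 * (LINT p|M. fst p * snd p) - 3"
proof -
  have "(THE M. copula_measure C M) = M"
    using assms copula_measure_unique by blast
  then show ?thesis by (simp add: spearman_rho_def)
qed

lemma copula_measure_tail:
  assumes "copula_measure C M" "u \<in> {0..1}" "v \<in> {0..1}"
  shows "measure M ({u<..} \<times> {v<..}) = 1 - u - v + C u v"
proof -
  interpret prob_space M using assms by (simp add: copula_measure_def)
  have s: "sets M = sets borel" using assms by (simp add: copula_measure_def)
  then have sp: "space M = UNIV" by (simp add: sets_eq_imp_space_eq)
  have b: "A \<times> B \<in> sets M" if "A \<in> sets borel" "B \<in> sets borel" for A B :: "real set"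
    using that by (simp add: s borel_prod[symmetric] del: borel_prod)
  have f: "fst \<in> borel_measurable M" and g: "snd \<in> borel_measurable M"
    using s by (simp_all add: borel_prod[symmetric] cong: measurable_cong_sets del: borel_prod)
  have un: "measure (uniform_measure lborel {0..1}) {..t} = t" if "t \<in> {0..1}" for t :: real
  proof -
    have "{0..1} \<inter> {..t} = {0..t}" using that by auto
    then show ?thesis using that by (simp add: measure_uniform_measure)
  qed
  have 1: "measure M ({..u} \<times> UNIV) = u"
  proof -
    have "measure (distr M borel fst) {..u} = measure M ({..u} \<times> UNIV)"
      by (subst measure_distr[OF f]) (auto simp: sp intro!: arg_cong[where f = "measure M"])
    then show ?thesis using assms un by (simp add: copula_measure_def)
  qed
  have 2: "measure M (UNIV \<times> {..v}) = v"
  proof -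
    have "measure (distr M borel snd) {..v} = measure M (UNIV \<times> {..v})"
      by (subst measure_distr[OF g]) (auto simp: sp intro!: arg_cong[where f = "measure M"])
    then show ?thesis using assms un by (simp add: copula_measure_def)
  qed
  let ?A = "{..u} \<times> (UNIV :: real set)" and ?B = "(UNIV :: real set) \<times> {..v}"
  have 3: "measure M (?A \<union> ?B) = u + v - C u v"
  proof -
    have "?A \<inter> ?B = {..u} \<times> {..v}" by auto
    then have "measure M (?A \<inter> ?B) = C u v"
      using assms by (simp add: copula_measure_def)
    then show ?thesis
      using measure_Un3[of ?A M ?B] 1 2 b by (simp add: fmeasurable_eq_sets)
  qed
  have "{u<..} \<times> {v<..} = space M - (?A \<union> ?B)" using sp by auto
  then have "measure M ({u<..} \<times> {v<..}) = 1 - measure M (?A \<union> ?B)"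
    using b by (simp add: prob_compl)
  then show ?thesis using 3 by simp
qed

lemma integral_unit_square_tails:
  defines "h \<equiv> \<lambda>q :: real \<times> real. indicator ({0..1} \<times> {0..1}) q * ((1 - fst q) * (1 - snd q)) :: real"
  shows "integrable lborel h" "integral\<^sup>L lborel h = 1 / 4"
proof -
  let ?k = "\<lambda>x :: real. (1 - x) * indicator {0..1} x"
  have "integrable lborel (\<lambda>q :: real \<times> real.
      indicator ({0..1} \<times> {0..1}) q *\<^sub>R ((1 - fst q) * (1 - snd q)))"
    by (intro borel_integrable_compact compact_Times continuous_intros) auto
  then show i: "integrable lborel h" by (simp add: h_def)
  have k: "integral\<^sup>L lborel ?k = 1 / 2"
  proof (subst integral_FTC_Icc_real[where F = "\<lambda>x. x - x^2 / 2"])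
    fix x :: real
    show "DERIV (\<lambda>x. x - x^2 / 2) x :> 1 - x"
      by (auto intro!: derivative_eq_intros)
  qed auto
  have "integral\<^sup>L lborel h = (\<integral>x. (\<integral>y. h (x, y) \<partial>lborel) \<partial>lborel)"
    using lborel_pair.integral_fst'[of h] i by (simp add: lborel_prod)
  also have "\<dots> = (\<integral>x. (\<integral>y. ?k x * ?k y \<partial>lborel) \<partial>lborel)"
    by (intro Bochner_Integration.integral_cong refl)
      (auto simp: h_def indicator_def)
  also have "\<dots> = (\<integral>x. ?k x * (1 / 2) \<partial>lborel)"
    by (simp only: integral_mult_right_zero k)
  also have "\<dots> = 1 / 4"
    by (subst integral_mult_left_zero, subst k) simp
  finally show "integral\<^sup>L lborel h = 1 / 4" .
qed

lemma spearman_rho_eq_lborel: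
  assumes "copula C"
  shows "spearman_rho C =
    12 * (LINT p:{0..1} \<times> {0..1}|lborel. C (fst p) (snd p) - fst p * snd p)"
proof -
  obtain M where M: "copula_measure C M" using assms by (auto simp: copula_def)
  interpret prob_space M using M by (simp add: copula_measure_def)
  interpret P: pair_sigma_finite M "lborel :: (real \<times> real) measure" ..
  have s[measurable_cong]: "sets M = sets (borel \<Otimes>\<^sub>M borel)"
    using M by (simp only: copula_measure_def borel_prod)
  then have sp: "space M = UNIV" by (simp add: sets_eq_imp_space_eq space_pair_measure)
  define Q where "Q = {0..1::real} \<times> {0..1::real}"
  define S where "S = {z :: (real \<times> real) \<times> (real \<times> real). snd z \<in> Q \<and>
    fst (snd z) < fst (fst z) \<and> snd (snd z) < snd (fst z)}"
  have L: "sets (lborel :: (real \<times> real) measure) = sets (borel \<Otimes>\<^sub>M borel)"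
    by (subst borel_prod) (rule sets_lborel)
  have Q[measurable]: "Q \<in> sets (borel \<Otimes>\<^sub>M borel)"
    unfolding Q_def by measurable
  have S: "S \<in> sets (M \<Otimes>\<^sub>M lborel)"
  proof -
    have "S = {z \<in> space ((borel \<Otimes>\<^sub>M borel) \<Otimes>\<^sub>M (borel \<Otimes>\<^sub>M borel)). snd z \<in> Q \<and>
      fst (snd z) < fst (fst z) \<and> snd (snd z) < snd (fst z)}"
      by (simp add: S_def space_pair_measure)
    also have "\<dots> \<in> sets ((borel \<Otimes>\<^sub>M borel) \<Otimes>\<^sub>M (borel \<Otimes>\<^sub>M borel))"
      by measurable
    also have "\<dots> = sets (M \<Otimes>\<^sub>M lborel)"
      by (rule sets_pair_measure_cong[OF s[symmetric] L[symmetric]])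
    finally show ?thesis .
  qed
  have box: "emeasure lborel (A \<times> B) = emeasure lborel A * emeasure lborel B"
    if "A \<in> sets borel" "B \<in> sets borel" for A B :: "real set"
    using that by (simp add: lborel_prod[symmetric] lborel.emeasure_pair_measure_Times del: lborel_prod)
  have fin: "emeasure (M \<Otimes>\<^sub>M lborel) S < \<infinity>"
  proof -
    have "emeasure (M \<Otimes>\<^sub>M lborel) S \<le> emeasure (M \<Otimes>\<^sub>M lborel) (space M \<times> Q)"
    proof (rule emeasure_mono)
      show "space M \<times> Q \<in> sets (M \<Otimes>\<^sub>M lborel)"
        by (rule pair_measureI[OF sets.top Q[folded L]])
    qed (auto simp: S_def sp)
    also have "\<dots> = 1"
      by (subst lborel.emeasure_pair_measure_Times[OF sets.top Q[folded L]])
        (simp add: emeasure_space_1 box Q_def)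
    finally show ?thesis by (auto intro: le_less_trans)
  qed
  define f where "f = (\<lambda>p q. indicator S (p, q) :: real)"
  have f: "integrable (M \<Otimes>\<^sub>M lborel) (case_prod f)"
    using S fin by (simp add: f_def case_prod_beta')
  have in1: "AE p in M. (\<integral>q. f p q \<partial>lborel) = fst p * snd p"
    using copula_measure_AE[OF M]
  proof eventually_elim
    case (elim p)
    have "(\<integral>q. f p q \<partial>lborel) = (\<integral>q. indicator ({0..<fst p} \<times> {0..<snd p}) q \<partial>lborel)"
      using elim by (intro Bochner_Integration.integral_cong refl)
        (auto simp: f_def S_def Q_def indicator_def)
    also have "\<dots> = measure lborel ({0..<fst p} \<times> {0..<snd p})"
      by simp
    also have "\<dots> = fst p * snd p"
      using elim by (simp add: measure_def box enn2real_mult)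
    finally show ?case .
  qed
  have in2: "(\<integral>p. f p q \<partial>M) = indicator Q q * (1 - fst q - snd q + C (fst q) (snd q))" for q
  proof -
    have "(\<integral>p. f p q \<partial>M) = (\<integral>p. indicator Q q * indicator ({fst q<..} \<times> {snd q<..}) p \<partial>M)"
      by (intro Bochner_Integration.integral_cong refl)
        (auto simp: f_def S_def indicator_def)
    also have "\<dots> = indicator Q q * measure M ({fst q<..} \<times> {snd q<..})"
      by (simp add: sp)
    also have "\<dots> = indicator Q q * (1 - fst q - snd q + C (fst q) (snd q))"
      using copula_measure_tail[OF M] by (auto simp: Q_def indicator_def)
    finally show ?thesis .
  qed
  let ?c = "\<lambda>q. indicator Q q * (1 - fst q - snd q + C (fst q) (snd q))"
  let ?h = "\<lambda>q. indicator Q q * ((1 - fst q) * (1 - snd q)) :: real"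
  have c: "integrable lborel ?c"
    using P.integrable_snd[OF f] by (simp add: in2)
  have h: "integrable lborel ?h" "integral\<^sup>L lborel ?h = 1 / 4"
    using integral_unit_square_tails by (simp_all add: Q_def)
  have "(\<integral>p. fst p * snd p \<partial>M) = (\<integral>p. (\<integral>q. f p q \<partial>lborel) \<partial>M)"
  proof (rule integral_cong_AE)
    show "(\<lambda>p. \<integral>q. f p q \<partial>lborel) \<in> borel_measurable M"
      using P.integrable_fst[OF f] by simp
    show "AE p in M. fst p * snd p = (\<integral>q. f p q \<partial>lborel)"
      using in1 by eventually_elim simp
  qed measurable
  also have "\<dots> = (\<integral>q. ?c q \<partial>lborel)"
    using P.Fubini_integral[OF f] by (simp add: in2)
  finally have e: "(\<integral>p. fst p * snd p \<partial>M) = (\<integral>q. ?c q \<partial>lborel)" .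
  have "(\<integral>q. indicator Q q * (C (fst q) (snd q) - fst q * snd q) \<partial>lborel) =
      (\<integral>q. ?c q - ?h q \<partial>lborel)"
    by (intro Bochner_Integration.integral_cong refl) (simp add: algebra_simps)
  also have "\<dots> = (\<integral>q. ?c q \<partial>lborel) - 1 / 4"
    using c h by simp
  finally show ?thesis
    using e by (simp add: spearman_rho_eq[OF M] set_lebesgue_integral_def Q_def)
qed

end

theory Submission
  imports Defs
begin

text \<open>
  A copula gives nonnegative mass to rectangles, so with \<open>f = a g\<^sub>1\<close> and \<open>g = g\<^sub>2\<close> the product of a
  difference quotient of \<open>f\<close> and one of \<open>g\<close> is at least \<open>- 1\<close>. Unless \<open>f\<close> or \<open>g\<close> vanishes, both
  have difference quotients of both signs, so those of \<open>f\<close> have finite supremum \<open>\<alpha> > 0\<close> and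
  infimum \<open>- \<beta> < 0\<close>, and those of \<open>g\<close> lie in \<open>[- 1 / \<alpha>, 1 / \<beta>]\<close>. Below the tent with slopes
  \<open>\<alpha>\<close> and \<open>- \<beta>\<close> there is area \<open>\<alpha> \<beta> / (2 (\<alpha> + \<beta>))\<close>, and the corresponding area for \<open>g\<close> is
  \<open>1 / (2 (\<alpha> + \<beta>))\<close>; hence \<open>\<bar>\<integral>f \<integral>g\<bar> \<le> \<alpha> \<beta> / (4 (\<alpha> + \<beta>)\<^sup>2) \<le> 1 / 16\<close>, while
  \<open>\<rho>\<^sub>S = 12 \<integral>f \<integral>g\<close>. Equality holds for \<open>g\<^sub>1 = g\<^sub>2 = min u (1 - u)\<close> and \<open>a = \<plusminus> 1\<close>.
\<close>

section \<open>Rectangle masses, absolute continuity and Lipschitz functions\<close>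

text \<open>The L-shaped union of \<open>{..x} \<times> {..y'}\<close> and
  \<open>{..x'} \<times> {..y}\<close> lies inside \<open>{..x'} \<times> {..y'}\<close>.
  Inclusion-exclusion gives its mass, and monotonicity of the measure gives the inequality.\<close>

lemma copula_rectangle_nonneg:
  assumes "copula C" "0 \<le> x" "x \<le> x'" "x' \<le> 1" "0 \<le> y" "y \<le> y'" "y' \<le> 1"
  shows "0 \<le> C x' y' - C x y' - C x' y + C x y"
proof -
  obtain M where M: "copula_measure C M" using assms(1) by (auto simp: copula_def)
  interpret prob_space M using M by (simp add: copula_measure_def)
  have s: "{..u} \<times> {..v} \<in> sets M" for u v :: real
  proof -
    have "{..u} \<times> {..v} = {..(u, v)}" by auto
    then show ?thesis using M by (simp add: copula_measure_def)
  qed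
  have C: "measure M ({..u} \<times> {..v}) = C u v" if "0 \<le> u" "u \<le> 1" "0 \<le> v" "v \<le> 1" for u v
    using M that by (simp add: copula_measure_def)
  let ?A = "{..x} \<times> {..y'}" and ?B = "{..x'} \<times> {..y}"
  have i: "?A \<inter> ?B = {..x} \<times> {..y}" using assms by auto
  have "measure M (?A \<union> ?B) \<le> measure M ({..x'} \<times> {..y'})"
    using assms s by (intro finite_measure_mono) auto
  moreover have "measure M (?A \<union> ?B) = C x y' + C x' y - C x y"
    using measure_Un3[of ?A M ?B] s assms unfolding i by (simp add: fmeasurable_eq_sets C)
  ultimately show ?thesis using assms by (simp add: C)
qed

lemma absolutely_continuous_on_interval_imp_continuous_on:
  assumes "absolutely_continuous_on_interval a b f"
  shows "continuous_on {a..b} f"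
  unfolding continuous_on_iff
proof (intro ballI allI impI)
  fix x \<epsilon> :: real assume x: "x \<in> {a..b}" and e: "0 < \<epsilon>"
  from assms[unfolded absolutely_continuous_on_interval_def, THEN spec, THEN mp, OF e]
  obtain \<delta> where d: "\<delta> > 0" and *: "\<forall>(n::nat) x y.
        (\<forall>i<n. a \<le> x i \<and> x i \<le> y i \<and> y i \<le> b) \<and>
        (\<forall>i<n. \<forall>j<n. i \<noteq> j \<longrightarrow> {x i<..<y i} \<inter> {x j<..<y j} = {}) \<and>
        (\<Sum>i<n. y i - x i) < \<delta>
        \<longrightarrow> (\<Sum>i<n. \<bar>f (y i) - f (x i)\<bar>) < \<epsilon>"
    by (elim exE conjE)
  \<comment> \<open>A family of one interval suffices; \<open>min\<close> and \<open>max\<close>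
    order its endpoints, since \<open>x'\<close> may lie on either side of \<open>x\<close>.\<close>
  have "dist (f x') (f x) < \<epsilon>" if "x' \<in> {a..b}" "dist x' x < \<delta>" for x'
    using *[THEN spec, of 1, THEN spec, of "\<lambda>_. min x x'", THEN spec, of "\<lambda>_. max x x'"] that x
    by (auto simp: dist_real_def min_def max_def abs_minus_commute split: if_splits)
  then show "\<exists>d>0. \<forall>x'\<in>{a..b}. dist x' x < d \<longrightarrow> dist (f x') (f x) < \<epsilon>"
    using d by blast
qed

lemma lipschitz_imp_absolutely_continuous_on_interval:
  assumes "L-lipschitz_on {a..b} f"
  shows "absolutely_continuous_on_interval a b f"
  unfolding absolutely_continuous_on_interval_def
proof (intro allI impI)
  fix \<epsilon> :: real assume e: "0 < \<epsilon>"
  have L: "0 \<le> L" using assms by (rule lipschitz_on_nonneg)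
  show "\<exists>\<delta>>0. \<forall>(n::nat) x y.
        (\<forall>i<n. a \<le> x i \<and> x i \<le> y i \<and> y i \<le> b) \<and>
        (\<forall>i<n. \<forall>j<n. i \<noteq> j \<longrightarrow> {x i<..<y i} \<inter> {x j<..<y j} = {}) \<and>
        (\<Sum>i<n. y i - x i) < \<delta>
        \<longrightarrow> (\<Sum>i<n. \<bar>f (y i) - f (x i)\<bar>) < \<epsilon>"
  \<comment> \<open>Dividing by \<open>L + 1\<close> rather than \<open>L\<close> also covers
    \<open>L = 0\<close>.\<close>
  proof (intro exI[of _ "\<epsilon> / (L + 1)"] conjI allI impI; (elim conjE)?)
    show "0 < \<epsilon> / (L + 1)" using e L by simp
    fix n :: nat and x y :: "nat \<Rightarrow> real"
    assume xy: "\<forall>i<n. a \<le> x i \<and> x i \<le> y i \<and> y i \<le> b"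
      and s: "(\<Sum>i<n. y i - x i) < \<epsilon> / (L + 1)"
    have "(\<Sum>i<n. \<bar>f (y i) - f (x i)\<bar>) \<le> (\<Sum>i<n. L * (y i - x i))"
    proof (rule sum_mono)
      fix i assume "i \<in> {..<n}"
      then have "a \<le> x i \<and> x i \<le> y i \<and> y i \<le> b" using xy by simp
      then show "\<bar>f (y i) - f (x i)\<bar> \<le> L * (y i - x i)"
        using lipschitz_onD[OF assms, of "y i" "x i"] by (simp add: dist_real_def)
    qed
    also have "\<dots> \<le> (L + 1) * (\<Sum>i<n. y i - x i)"
      using xy unfolding sum_distrib_left by (intro sum_mono mult_right_mono) auto
    also have "\<dots> < \<epsilon>" using s L by (simp add: field_simps)
    finally show "(\<Sum>i<n. \<bar>f (y i) - f (x i)\<bar>) < \<epsilon>" .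
  qed
qed

section \<open>Spearman's rho as a product of two integrals\<close>

text \<open>Subtracting \<open>u1 * u2\<close> leaves an integrand with separated variables. It is
  continuous on the compact square, so its Lebesgue integral is the gauge integral over a
  \<open>cbox\<close>, which factors as an iterated integral.\<close>

lemma spearman_rho_product_perturbation:
  assumes "copula (product_perturbation a g1 g2)"
    and "continuous_on {0..1} g1" "continuous_on {0..1} g2"
  shows "spearman_rho (product_perturbation a g1 g2) =
    12 * a * integral {0..1} g1 * integral {0..1} g2"
proof -
  let ?f = "\<lambda>p :: real \<times> real. a * g1 (fst p) * g2 (snd p)"
  have Q: "{0..1} \<times> {0..1} = cbox (0 :: real, 0 :: real) (1, 1)"
    by (simp only: cbox_Pair_eq box_real)
  have c: "continuous_on (cbox (0, 0) (1, 1)) ?f"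
    unfolding Q[symmetric]
    by (intro continuous_intros continuous_on_compose2[OF assms(2)]
        continuous_on_compose2[OF assms(3)]) auto
  have i: "set_integrable lborel (cbox (0, 0) (1, 1)) ?f"
    using borel_integrable_compact[OF compact_cbox c] by (simp add: set_integrable_def)
  have "spearman_rho (product_perturbation a g1 g2) =
      12 * (LINT p:{0..1} \<times> {0..1}|lborel. ?f p)"
    by (subst spearman_rho_eq_lborel[OF assms(1)]) (simp add: product_perturbation_def)
  also have "(LINT p:{0..1} \<times> {0..1}|lborel. ?f p) = integral (cbox (0, 0) (1, 1)) ?f"
    unfolding Q by (rule set_borel_integral_eq_integral[OF i])
  also have "\<dots> = integral {0..1} (\<lambda>x. integral {0..1} (\<lambda>y. a * g1 x * g2 y))"
    using integral_prod_continuous[OF c] by (simp add: cbox_interval)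
  also have "\<dots> = a * integral {0..1} g1 * integral {0..1} g2"
    by simp
  finally show ?thesis by simp
qed

section \<open>Bounding the product of the integrals by difference quotients\<close>

text \<open>The lines \<open>\<alpha> * u\<close> and \<open>\<beta> * (1 - u)\<close> cross at
  \<open>m = \<beta> / (\<alpha> + \<beta>)\<close>. Using the first bound to the left of
  \<open>m\<close> and the second to the right gives the area of the triangle below both
  lines.\<close>

lemma integral_le_of_tent_bound:
  fixes f :: "real \<Rightarrow> real"
  assumes "continuous_on {0..1} f" "0 < \<alpha>" "0 < \<beta>"
    and "\<And>u. u \<in> {0..1} \<Longrightarrow> f u \<le> \<alpha> * u" "\<And>u. u \<in> {0..1} \<Longrightarrow> f u \<le> \<beta> * (1 - u)"
  shows "integral {0..1} f \<le> \<alpha> * \<beta> / (2 * (\<alpha> + \<beta>))"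
proof -
  define m where "m = \<beta> / (\<alpha> + \<beta>)"
  have m: "0 \<le> m" "m \<le> 1" using assms by (auto simp: m_def field_simps)
  have l: "((\<lambda>u. \<alpha> * u) has_integral \<alpha> * m^2 / 2 - \<alpha> * 0^2 / 2) {0..m}"
    using m by (intro fundamental_theorem_of_calculus)
      (auto intro!: derivative_eq_intros simp flip: has_real_derivative_iff_has_vector_derivative)
  \<comment> \<open>The value is kept as a difference of the antiderivative
    \<open>- (\<beta> * (1 - u)^2 / 2)\<close> at \<open>1\<close> and at \<open>m\<close>, the form
    in which the fundamental theorem applies.\<close>
  have r: "((\<lambda>u. \<beta> * (1 - u)) has_integral - (\<beta> * (1 - 1)^2 / 2) - - (\<beta> * (1 - m)^2 / 2)) {m..1}"
    using m by (intro fundamental_theorem_of_calculus)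
      (auto intro!: derivative_eq_intros
        simp: field_simps simp flip: has_real_derivative_iff_has_vector_derivative)
  have i: "f integrable_on {0..1}"
    by (rule integrable_continuous_interval[OF assms(1)])
  have "integral {0..m} f \<le> \<alpha> * m^2 / 2"
    using l m assms(4) by (intro integral_le[THEN order_trans, OF _ _ _ eq_refl[OF integral_unique]]
        integrable_on_subinterval[OF i]) auto
  moreover have "integral {m..1} f \<le> \<beta> * (1 - m)^2 / 2"
    using r m assms(5) by (intro integral_le[THEN order_trans, OF _ _ _ eq_refl[OF integral_unique]]
        integrable_on_subinterval[OF i]) auto
  moreover have "integral {0..m} f + integral {m..1} f = integral {0..1} f"
    using m i by (intro Henstock_Kurzweil_Integration.integral_combine)
  moreover have "\<alpha> * m^2 / 2 + \<beta> * (1 - m)^2 / 2 = \<alpha> * \<beta> / (2 * (\<alpha> + \<beta>))"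
  proof -
    define S where "S = \<alpha> + \<beta>"
    have m': "1 - m = \<alpha> / S" using assms by (simp add: m_def S_def field_simps)
    have "\<alpha> * m^2 / 2 + \<beta> * (1 - m)^2 / 2 = (\<alpha> * \<beta> * \<beta> + \<alpha> * \<alpha> * \<beta>) / (2 * (S * S))"
      unfolding m' by (simp add: m_def S_def[symmetric] power2_eq_square add_divide_distrib mult_ac)
    also have "\<dots> = \<alpha> * \<beta> * S / (2 * (S * S))"
      by (simp add: S_def algebra_simps)
    also have "\<dots> = \<alpha> * \<beta> / (2 * (\<alpha> + \<beta>))"
      unfolding S_def[symmetric] using assms S_def by simp
    finally show ?thesis .
  qed
  ultimately show ?thesis by simp
qed

text \<open>Slopes taken from the zero at \<open>0\<close> and to the zero at \<open>1\<close> put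
  \<open>f\<close> below the tent with slopes \<open>\<alpha>\<close> and \<open>- \<beta>\<close>.
  For \<open>- f\<close> the two constants swap roles, and the area is symmetric in them.\<close>

lemma abs_integral_le_of_slopes:
  fixes f :: "real \<Rightarrow> real"
  assumes "continuous_on {0..1} f" "f 0 = 0" "f 1 = 0" "0 < \<alpha>" "0 < \<beta>"
    and up: "\<And>x y. 0 \<le> x \<Longrightarrow> x < y \<Longrightarrow> y \<le> 1 \<Longrightarrow> f y - f x \<le> \<alpha> * (y - x)"
    and lo: "\<And>x y. 0 \<le> x \<Longrightarrow> x < y \<Longrightarrow> y \<le> 1 \<Longrightarrow> - \<beta> * (y - x) \<le> f y - f x"
  shows "\<bar>integral {0..1} f\<bar> \<le> \<alpha> * \<beta> / (2 * (\<alpha> + \<beta>))"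
proof -
  have "f u \<le> \<alpha> * u \<and> - f u \<le> \<beta> * u \<and> f u \<le> \<beta> * (1 - u) \<and> - f u \<le> \<alpha> * (1 - u)"
    if "u \<in> {0..1}" for u
    using that up[of 0 u] lo[of 0 u] up[of u 1] lo[of u 1] assms
    by (cases "u = 0"; cases "u = 1") auto
  note tent = this
  have "integral {0..1} f \<le> \<alpha> * \<beta> / (2 * (\<alpha> + \<beta>))"
    by (rule integral_le_of_tent_bound) (use assms tent in auto)
  moreover have "integral {0..1} (\<lambda>u. - f u) \<le> \<beta> * \<alpha> / (2 * (\<beta> + \<alpha>))"
    by (rule integral_le_of_tent_bound) (use assms tent in \<open>auto intro: continuous_on_minus\<close>)
  ultimately show ?thesis by (simp add: ac_simps)
qed

text \<open>Starting at zero, reaching a nonzero value at \<open>u\<close> and returning to zero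
  forces one rise and one fall; the sign of \<open>g u\<close> decides which of
  \<open>[0, u]\<close> and \<open>[u, 1]\<close> carries which.\<close>

lemma slopes_of_both_signs:
  fixes g :: "real \<Rightarrow> real"
  assumes "g 0 = 0" "g 1 = 0" "u \<in> {0..1}" "g u \<noteq> 0"
  obtains x y x' y' where "0 \<le> x" "x < y" "y \<le> 1" "g x < g y"
    "0 \<le> x'" "x' < y'" "y' \<le> 1" "g y' < g x'"
proof -
  have "0 < u" "u < 1" using assms by (auto simp: less_le)
  show ?thesis
  proof (cases "0 < g u")
    case True
    show ?thesis
      by (rule that[of 0 u u 1]) (use \<open>0 < u\<close> \<open>u < 1\<close> True assms in simp_all)
  next
    case False
    show ?thesis
      by (rule that[of u 1 0 u]) (use \<open>0 < u\<close> \<open>u < 1\<close> False assms in simp_all)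
  qed
qed

lemma abs_integral_mult_integral_le:
  fixes f g :: "real \<Rightarrow> real"
  assumes cont: "continuous_on {0..1} f" "continuous_on {0..1} g"
    and ends: "f 0 = 0" "f 1 = 0" "g 0 = 0" "g 1 = 0"
    and rect: "\<And>x x' y y'. 0 \<le> x \<Longrightarrow> x < x' \<Longrightarrow> x' \<le> 1 \<Longrightarrow> 0 \<le> y \<Longrightarrow> y < y' \<Longrightarrow> y' \<le> 1 \<Longrightarrow>
      - ((x' - x) * (y' - y)) \<le> (f x' - f x) * (g y' - g y)"
  shows "\<bar>integral {0..1} f * integral {0..1} g\<bar> \<le> 1 / 16"
proof (cases "(\<forall>u\<in>{0..1}. f u = 0) \<or> (\<forall>u\<in>{0..1}. g u = 0)")
  case True
  then have "integral {0..1} f = 0 \<or> integral {0..1} g = 0"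
    using Henstock_Kurzweil_Integration.integral_cong[of "{0..1}" f "\<lambda>_. 0"]
      Henstock_Kurzweil_Integration.integral_cong[of "{0..1}" g "\<lambda>_. 0"] by auto
  then show ?thesis by auto
next
  case False
  define slopes where
    "slopes h = {(h y - h x) / (y - x) | x y. 0 \<le> x \<and> x < y \<and> y \<le> 1}" for h :: "real \<Rightarrow> real"
  have both: "(\<exists>s\<in>slopes h. 0 < s) \<and> (\<exists>s\<in>slopes h. s < 0)"
    if h: "h 0 = 0" "h 1 = 0" "u \<in> {0..1}" "h u \<noteq> 0" for h u
  proof -
    obtain x y x' y' where "0 \<le> x" "x < y" "y \<le> 1" "h x < h y"
      "0 \<le> x'" "x' < y'" "y' \<le> 1" "h y' < h x'"
      by (rule slopes_of_both_signs[OF h])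
    moreover from this have "0 < (h y - h x) / (y - x)" "(h y' - h x') / (y' - x') < 0"
      by (auto simp: divide_less_0_iff)
    ultimately show ?thesis unfolding slopes_def by blast
  qed
  from False obtain u v where uv: "u \<in> {0..1}" "f u \<noteq> 0" "v \<in> {0..1}" "g v \<noteq> 0" by blast
  from both[of f u] ends uv obtain s1 s2
    where s: "s1 \<in> slopes f" "0 < s1" "s2 \<in> slopes f" "s2 < 0" by blast
  from both[of g v] ends uv obtain t1 t2
    where t: "t1 \<in> slopes g" "0 < t1" "t2 \<in> slopes g" "t2 < 0" by blast
  have st: "- 1 \<le> s * t" if slopes: "s \<in> slopes f" "t \<in> slopes g" for s t
  proof -
    obtain x x' where x: "s = (f x' - f x) / (x' - x)" "0 \<le> x" "x < x'" "x' \<le> 1"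
      using slopes(1) by (auto simp: slopes_def)
    obtain y y' where y: "t = (g y' - g y) / (y' - y)" "0 \<le> y" "y < y'" "y' \<le> 1"
      using slopes(2) by (auto simp: slopes_def)
    have "0 < (x' - x) * (y' - y)" using x y by simp
    moreover have "- ((x' - x) * (y' - y)) \<le> (f x' - f x) * (g y' - g y)"
      using rect x y by blast
    ultimately show ?thesis by (simp add: x(1) y(1) le_divide_eq)
  qed
  define \<alpha> where "\<alpha> = Sup (slopes f)"
  define \<beta> where "\<beta> = - Inf (slopes f)"
  have ba: "bdd_above (slopes f)"
    \<comment> \<open>A single negative slope \<open>t2\<close> of \<open>g\<close> bounds all
      slopes of \<open>f\<close> from above, by \<open>st\<close>; in the same way the positive
      slope \<open>t1\<close> bounds them from below.\<close>
    using st[OF _ t(3)] t(4) by (intro bdd_aboveI[of _ "- 1 / t2"]) (simp add: field_simps)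
  have bb: "bdd_below (slopes f)"
    using st[OF _ t(1)] t(2) by (intro bdd_belowI[of _ "- 1 / t1"]) (simp add: field_simps)
  have \<alpha>: "s \<le> \<alpha>" and \<beta>: "- \<beta> \<le> s" if "s \<in> slopes f" for s
    using that ba bb by (auto simp: \<alpha>_def \<beta>_def intro: cSup_upper cInf_lower)
  have pos: "0 < \<alpha>" "0 < \<beta>" using \<alpha>[OF s(1)] \<beta>[OF s(3)] s by auto
  have g_lo: "- (1 / \<alpha>) \<le> t" if "t \<in> slopes g" for t
  proof (cases "t < 0")
    case True
    \<comment> \<open>For fixed \<open>t < 0\<close>, dividing \<open>- 1 \<le> s * t\<close> by
      \<open>t\<close> makes \<open>- 1 / t\<close> an upper bound of all slopes \<open>s\<close> of
      \<open>f\<close>, hence of their supremum. Solving for \<open>t\<close> gives the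
      claim.\<close>
    have "\<alpha> \<le> - 1 / t" unfolding \<alpha>_def
      using s(1) st[OF _ that] True by (intro cSup_least) (auto simp: field_simps)
    then show ?thesis using True pos by (simp add: field_simps)
  next
    case False
    have "0 \<le> 1 / \<alpha>" using pos by simp
    then show ?thesis using False by linarith
  qed
  have g_up: "t \<le> 1 / \<beta>" if "t \<in> slopes g" for t
  proof (cases "0 < t")
    case True
    \<comment> \<open>Now \<open>t > 0\<close>, so \<open>- 1 / t\<close> is a lower bound of the
      slopes of \<open>f\<close> and thus at most their infimum.\<close>
    have "- 1 / t \<le> - \<beta>" unfolding \<beta>_def minus_minus
      using s(1) st[OF _ that] True by (intro cInf_greatest) (auto simp: field_simps)
    then show ?thesis using True pos by (simp add: field_simps)
  next
    case False
    have "0 \<le> 1 / \<beta>" using pos by simp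
    then show ?thesis using False by linarith
  qed
  have slopeI: "(h y - h x) / (y - x) \<in> slopes h" if "0 \<le> x" "x < y" "y \<le> 1" for h x y
    using that by (auto simp: slopes_def)
  have F: "\<bar>integral {0..1} f\<bar> \<le> \<alpha> * \<beta> / (2 * (\<alpha> + \<beta>))"
  proof (rule abs_integral_le_of_slopes[OF cont(1) ends(1,2) pos])
    fix x y :: real assume xy: "0 \<le> x" "x < y" "y \<le> 1"
    show "f y - f x \<le> \<alpha> * (y - x)" "- \<beta> * (y - x) \<le> f y - f x"
      using \<alpha>[OF slopeI[OF xy]] \<beta>[OF slopeI[OF xy]] xy by (auto simp: divide_le_eq le_divide_eq)
  qed
  \<comment> \<open>The same area bound is applied to \<open>g\<close>, with
    \<open>1 / \<beta>\<close> as the upper slope and \<open>1 / \<alpha>\<close> as the size of the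
    lower one.\<close>
  have "\<bar>integral {0..1} g\<bar> \<le> (1 / \<beta>) * (1 / \<alpha>) / (2 * (1 / \<beta> + 1 / \<alpha>))"
  proof (rule abs_integral_le_of_slopes[OF cont(2) ends(3,4)])
    fix x y :: real assume xy: "0 \<le> x" "x < y" "y \<le> 1"
    show "g y - g x \<le> 1 / \<beta> * (y - x)"
      using g_up[OF slopeI[OF xy]] xy pos by (simp add: pos_divide_le_eq)
    show "- (1 / \<alpha>) * (y - x) \<le> g y - g x"
      using g_lo[OF slopeI[OF xy]] xy by (subst (asm) pos_le_divide_eq) auto
  qed (use pos in auto)
  also have "\<dots> = 1 / (2 * (\<alpha> + \<beta>))"
    using pos by (simp add: field_simps)
  finally have G: "\<bar>integral {0..1} g\<bar> \<le> 1 / (2 * (\<alpha> + \<beta>))" .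
  have "\<bar>integral {0..1} f * integral {0..1} g\<bar> \<le>
      (\<alpha> * \<beta> / (2 * (\<alpha> + \<beta>))) * (1 / (2 * (\<alpha> + \<beta>)))"
    unfolding abs_mult using F G pos by (intro mult_mono) auto
  also have "\<dots> = \<alpha> * \<beta> / (4 * (\<alpha> + \<beta>)^2)"
    by (simp add: power2_eq_square distrib_left distrib_right)
  also have "\<dots> \<le> 1 / 16"
  proof -
    \<comment> \<open>Arithmetic-geometric mean inequality, with equality for
      \<open>\<alpha> = \<beta>\<close>, the symmetric tent.\<close>
    have "4 * (\<alpha> * \<beta>) \<le> (\<alpha> + \<beta>)^2"
      using zero_le_power2[of "\<alpha> - \<beta>"] by (simp add: power2_eq_square algebra_simps)
    then show ?thesis using pos by (subst pos_divide_le_eq) auto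
  qed
  finally show ?thesis .
qed

text \<open>The factor \<open>a\<close> is absorbed into \<open>g1\<close>. In the rectangle mass
  the terms from \<open>u1 * u2\<close> give \<open>(x' - x) * (y' - y)\<close>, so its
  nonnegativity is exactly the hypothesis on products of increments; finally
  \<open>12 / 16 = 3 / 4\<close>.\<close>

lemma abs_spearman_rho_product_perturbation_le:
  assumes C: "copula (product_perturbation a g1 g2)"
    and g: "continuous_on {0..1} g1" "continuous_on {0..1} g2"
      "g1 0 = 0" "g1 1 = 0" "g2 0 = 0" "g2 1 = 0"
  shows "\<bar>spearman_rho (product_perturbation a g1 g2)\<bar> \<le> 3 / 4"
proof -
  have "\<bar>integral {0..1} (\<lambda>u. a * g1 u) * integral {0..1} g2\<bar> \<le> 1 / 16"
  proof (rule abs_integral_mult_integral_le)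
    fix x x' y y' :: real
    assume "0 \<le> x" "x < x'" "x' \<le> 1" "0 \<le> y" "y < y'" "y' \<le> 1"
    then show "- ((x' - x) * (y' - y)) \<le> (a * g1 x' - a * g1 x) * (g2 y' - g2 y)"
      using copula_rectangle_nonneg[OF C, of x x' y y']
      by (simp add: product_perturbation_def algebra_simps)
  qed (use g in \<open>auto intro!: continuous_intros\<close>)
  then show ?thesis
    unfolding spearman_rho_product_perturbation[OF C g(1,2)] by (simp add: abs_mult)
qed

section \<open>Copulas from a density\<close>

lemma (in pair_sigma_finite) has_bochner_integral_fst_mult_snd:
  fixes f g :: "_ \<Rightarrow> real"
  assumes [measurable]: "integrable M1 f" "integrable M2 g"
  shows "has_bochner_integral (M1 \<Otimes>\<^sub>M M2) (\<lambda>p. f (fst p) * g (snd p))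
    (integral\<^sup>L M1 f * integral\<^sup>L M2 g)"
proof -
  have i: "integrable (M1 \<Otimes>\<^sub>M M2) (\<lambda>p. f (fst p) * g (snd p))"
    using assms by (intro Fubini_integrable) (auto simp: abs_mult)
  moreover have "integral\<^sup>L (M1 \<Otimes>\<^sub>M M2) (\<lambda>p. f (fst p) * g (snd p)) =
      integral\<^sup>L M1 f * integral\<^sup>L M2 g"
    using integral_fst'[OF i] by simp
  ultimately show ?thesis by (simp add: has_bochner_integral_iff)
qed

lemma uniform_measure_unit_interval:
  "uniform_measure lborel {0..1::real} = density lborel (indicator {0..1})"
  by (simp add: uniform_measure_def divide_ennreal_def)

text \<open>The witness is the law on the unit square with density
  \<open>1 + a * d1 x * d2 y\<close>. Its margins are uniform because \<open>d1\<close> and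
  \<open>d2\<close> integrate to \<open>g1 1 = 0\<close> and \<open>g2 1 = 0\<close>, and
  integrating the density over \<open>[0, u] \<times> [0, v]\<close> gives the required distribution
  function.\<close>

lemma copula_product_perturbationI:
  fixes d1 d2 g1 g2 :: "real \<Rightarrow> real"
  assumes d[measurable]: "d1 \<in> borel_measurable borel" "d2 \<in> borel_measurable borel"
    and bounded: "\<And>x. \<bar>d1 x\<bar> \<le> B\<^sub>1" "\<And>x. \<bar>d2 x\<bar> \<le> B\<^sub>2"
    and nonneg: "\<And>x y. 0 \<le> 1 + a * d1 x * d2 y"
    and g: "\<And>u. u \<in> {0..1} \<Longrightarrow> (LBINT x:{0..u}. d1 x) = g1 u"
      "\<And>u. u \<in> {0..1} \<Longrightarrow> (LBINT x:{0..u}. d2 x) = g2 u"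
    and g_end: "g1 1 = 0" "g2 1 = 0"
  shows "copula (product_perturbation a g1 g2)"
proof -
  define U where "U = uniform_measure lborel {0..1::real}"
  interpret U: prob_space U
    unfolding U_def by (rule prob_space_uniform_measure) auto
  have U_space: "space U = UNIV" by (simp add: U_def)
  interpret UU: pair_prob_space U U ..
  have s[measurable_cong]: "sets U = sets borel" by (simp add: U_def)
  define M where "M = density (U \<Otimes>\<^sub>M U) (\<lambda>p. ennreal (1 + a * d1 (fst p) * d2 (snd p)))"
  have sM: "sets M = sets borel"
    unfolding M_def sets_density sets_pair_measure_cong[OF s s] borel_prod ..
  have spM: "space M = UNIV" using sM by (simp add: sets_eq_imp_space_eq)
  have U_int: "(LINT x|U. indicator A x * d x) = (LBINT x:{0..1} \<inter> A. d x)"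
    if [measurable]: "A \<in> sets borel" "d \<in> borel_measurable borel" for A and d :: "real \<Rightarrow> real"
  proof -
    have "U = density lborel (\<lambda>x. ennreal (indicator {0..1} x))"
      by (simp add: U_def uniform_measure_unit_interval ennreal_indicator)
    then have "(LINT x|U. indicator A x * d x) = (LBINT x. indicator {0..1} x * (indicator A x * d x))"
      by (simp add: integral_density)
    also have "\<dots> = (LBINT x:{0..1} \<inter> A. d x)"
      by (simp add: set_lebesgue_integral_def indicator_inter_arith mult.assoc)
    finally show ?thesis .
  qed
  have U_g: "(LINT x|U. indicator {..u} x * d1 x) = g1 u" "(LINT x|U. indicator {..u} x * d2 x) = g2 u"
    if "u \<in> {0..1}" for u
  proof -
    have "{0..1} \<inter> {..u} = {0..u}" using that by auto
    then show "(LINT x|U. indicator {..u} x * d1 x) = g1 u" "(LINT x|U. indicator {..u} x * d2 x) = g2 u"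
      using g that by (simp_all add: U_int)
  qed
  have U_UNIV: "(LINT x|U. indicator UNIV x * d1 x) = 0" "(LINT x|U. indicator UNIV x * d2 x) = 0"
    using g[of 1] g_end U_int[of UNIV d1] U_int[of UNIV d2] by simp_all
  have d_int: "integrable U d1" "integrable U d2"
    using bounded
    by (auto intro!: U.integrable_const_bound[of d1 B\<^sub>1] U.integrable_const_bound[of d2 B\<^sub>2])
  \<comment> \<open>Total mass, both margins and the distribution function are all instances of this
    formula. Nonnegativity of the right-hand side is recorded too, so that \<open>ennreal\<close>
    can be removed when passing to \<open>measure\<close>.\<close>
  have rect: "emeasure M (A \<times> B) = ennreal (U.prob A * U.prob B +
      a * (LINT x|U. indicator A x * d1 x) * (LINT x|U. indicator B x * d2 x))"
    and rect_nonneg: "0 \<le> U.prob A * U.prob B +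
      a * (LINT x|U. indicator A x * d1 x) * (LINT x|U. indicator B x * d2 x)"
    if [measurable]: "A \<in> sets borel" "B \<in> sets borel" for A B
  proof -
    \<comment> \<open>The density restricted to \<open>A \<times> B\<close>, expanded into products
      of a function of \<open>fst p\<close> and one of \<open>snd p\<close>, so that each term
      integrates to a product.\<close>
    let ?f = "\<lambda>p. indicator A (fst p) * indicator B (snd p) +
      a * ((indicator A (fst p) * d1 (fst p)) * (indicator B (snd p) * d2 (snd p)))"
    have AB: "A \<times> B \<in> sets (U \<Otimes>\<^sub>M U)" by (intro pair_measureI) (simp_all add: s)
    have i: "integrable U (\<lambda>x. indicator A x * d1 x)" "integrable U (\<lambda>x. indicator B x * d2 x)"
      "integrable U (indicator A :: _ \<Rightarrow> real)" "integrable U (indicator B :: _ \<Rightarrow> real)"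
      using integrable_mult_indicator[OF _ d_int(1), of A]
        integrable_mult_indicator[OF _ d_int(2), of B]
      by (auto simp: s less_top[symmetric] intro!: integrable_real_indicator)
    have f: "has_bochner_integral (U \<Otimes>\<^sub>M U) ?f (U.prob A * U.prob B +
      a * ((LINT x|U. indicator A x * d1 x) * (LINT x|U. indicator B x * d2 x)))"
      using UU.has_bochner_integral_fst_mult_snd[OF i(3,4)] UU.has_bochner_integral_fst_mult_snd[OF i(1,2)]
      by (intro has_bochner_integral_add has_bochner_integral_mult_right) (simp_all add: s)
    have eq: "?f p = (1 + a * d1 (fst p) * d2 (snd p)) * indicator (A \<times> B) p" for p
      by (cases p) (auto simp: indicator_def)
    then have f0: "0 \<le> ?f p" for p using nonneg by simp
    have "emeasure M (A \<times> B) = (\<integral>\<^sup>+p. ennreal (?f p) \<partial>(U \<Otimes>\<^sub>M U))"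
      unfolding M_def eq using AB nonneg
      by (subst emeasure_density) (auto simp: ennreal_mult' ennreal_indicator)
    also have "\<dots> = ennreal (integral\<^sup>L (U \<Otimes>\<^sub>M U) ?f)"
      using f f0 by (intro nn_integral_eq_integral) (auto simp: has_bochner_integral_iff)
    finally show "emeasure M (A \<times> B) = ennreal (U.prob A * U.prob B +
      a * (LINT x|U. indicator A x * d1 x) * (LINT x|U. indicator B x * d2 x))"
      using f by (simp add: has_bochner_integral_iff mult.assoc)
    have "0 \<le> integral\<^sup>L (U \<Otimes>\<^sub>M U) ?f"
      using f0 by (intro Bochner_Integration.integral_nonneg)
    then show "0 \<le> U.prob A * U.prob B +
      a * (LINT x|U. indicator A x * d1 x) * (LINT x|U. indicator B x * d2 x)"
      using f by (simp add: has_bochner_integral_iff mult.assoc)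
  qed
  have margin: "emeasure M (A \<times> UNIV) = emeasure U A" "emeasure M (UNIV \<times> A) = emeasure U A"
    if "A \<in> sets borel" for A
    using that U_UNIV U_space U.prob_space by (simp_all add: rect U.emeasure_eq_measure)
  have m: "fst \<in> borel_measurable M" "snd \<in> borel_measurable M"
    using sM by (simp_all add: borel_prod[symmetric] cong: measurable_cong_sets del: borel_prod)
  have "prob_space M"
    using margin[of UNIV] U.emeasure_space_1 U_space spM by (intro prob_spaceI) simp
  have "distr M borel fst = U"
  proof (rule measure_eqI)
    fix A assume "A \<in> sets (distr M borel fst)"
    then have A: "A \<in> sets borel" by simp
    have "emeasure (distr M borel fst) A = emeasure M (A \<times> UNIV)"
      using m A by (subst emeasure_distr) (auto simp: spM intro!: arg_cong[where f = "emeasure M"])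
    then show "emeasure (distr M borel fst) A = emeasure U A"
      using margin[OF A] by simp
  qed (simp add: s)
  moreover have "distr M borel snd = U"
  proof (rule measure_eqI)
    fix A assume "A \<in> sets (distr M borel snd)"
    then have A: "A \<in> sets borel" by simp
    have "emeasure (distr M borel snd) A = emeasure M (UNIV \<times> A)"
      using m A by (subst emeasure_distr) (auto simp: spM intro!: arg_cong[where f = "emeasure M"])
    then show "emeasure (distr M borel snd) A = emeasure U A"
      using margin[OF A] by simp
  qed (simp add: s)
  moreover have "product_perturbation a g1 g2 u v = measure M ({..u} \<times> {..v})"
    if uv: "u \<in> {0..1}" "v \<in> {0..1}" for u v
  proof -
    have U_le: "U.prob {..t} = t" if "t \<in> {0..1}" for t
    proof -
      have "{0..1} \<inter> {..t} = {0..t}" using that by auto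
      then show ?thesis using that by (simp add: U_def measure_uniform_measure)
    qed
    show ?thesis
      using uv rect[of "{..u}" "{..v}"] rect_nonneg[of "{..u}" "{..v}"]
      by (simp add: measure_def[of M] U_g U_le product_perturbation_def)
  qed
  ultimately have "copula_measure (product_perturbation a g1 g2) M"
    using \<open>prob_space M\<close> sM by (simp add: copula_measure_def U_def)
  then show ?thesis by (auto simp: copula_def)
qed

section \<open>The extremal example: the tent function\<close>

lemma tent_has_real_derivative:
  fixes x :: real
  assumes "x \<noteq> 1 / 2"
  shows "((\<lambda>x. min x (1 - x)) has_real_derivative (if x < 1 / 2 then 1 else - 1)) (at x)"
proof (cases "x < 1 / 2")
  case True
  have "((\<lambda>x. min x (1 - x)) has_real_derivative 1) (at x)"
    by (rule has_field_derivative_transform_within_open[of "\<lambda>x. x" _ _ "{..<1/2}"])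
      (use True in auto)
  then show ?thesis using True by simp
next
  case False
  have "((\<lambda>x. min x (1 - x)) has_real_derivative - 1) (at x)"
    by (rule has_field_derivative_transform_within_open[of "\<lambda>x. 1 - x" _ _ "{1/2<..}"])
      (use False assms in \<open>auto intro!: derivative_eq_intros\<close>)
  then show ?thesis using False by simp
qed

lemma set_integral_tent_derivative:
  assumes "u \<in> {0..1::real}"
  shows "(LBINT x:{0..u}. if x < 1 / 2 then 1 else - 1) = min u (1 - u)"
proof -
  have "((\<lambda>x. if x < 1 / 2 then 1 else - 1) has_integral min u (1 - u) - min 0 (1 - 0)) {0..u}"
  proof (rule fundamental_theorem_of_calculus_strong[where S = "{1/2}"])
    fix x assume "x \<in> {0..u} - {1 / 2}"
    then show "((\<lambda>x. min x (1 - x)) has_vector_derivative (if x < 1 / 2 then 1 else - 1)) (at x)"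
      using tent_has_real_derivative[of x] by (simp add: has_real_derivative_iff_has_vector_derivative)
  qed (use assms in \<open>auto intro!: continuous_intros\<close>)
  \<comment> \<open>Lebesgue integrability of the bounded step function lets the gauge integral just
    computed be read as a Lebesgue integral.\<close>
  moreover have "set_integrable lborel {0..u} (\<lambda>x. if x < 1 / 2 then 1 else - 1 :: real)"
    unfolding set_integrable_def
    by (rule integrableI_bounded_set_indicator[where B = 1]) (use assms in auto)
  ultimately show ?thesis
    by (simp add: set_borel_integral_eq_integral integral_unique)
qed

lemma integral_tent: "integral {0..1} (\<lambda>x::real. min x (1 - x)) = 1 / 4"
proof -
  \<comment> \<open>The constant \<open>- 1 / 4\<close> makes the two branches of the antiderivative
    agree at \<open>1 / 2\<close>, where both equal \<open>1 / 8\<close>.\<close>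
  let ?F = "\<lambda>x::real. if x \<le> 1 / 2 then x^2 / 2 else x - x^2 / 2 - 1 / 4"
  have "((\<lambda>x. min x (1 - x)) has_integral ?F 1 - ?F 0) {0..1}"
  proof (rule fundamental_theorem_of_calculus_strong[where S = "{1/2}"])
    fix x :: real assume x: "x \<in> {0..1} - {1 / 2}"
    have "(?F has_real_derivative min x (1 - x)) (at x)"
    proof (cases "x < 1 / 2")
      case True
      then show ?thesis
        by (intro has_field_derivative_transform_within_open[of "\<lambda>x. x^2 / 2" _ _ "{..<1/2}" ?F])
          (auto intro!: derivative_eq_intros)
    next
      case False
      then show ?thesis using x
        by (intro has_field_derivative_transform_within_open
            [of "\<lambda>x. x - x^2 / 2 - 1 / 4" _ _ "{1/2<..}" ?F])
          (auto intro!: derivative_eq_intros)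
    qed
    then show "(?F has_vector_derivative min x (1 - x)) (at x)"
      by (simp add: has_real_derivative_iff_has_vector_derivative)
  next
    have "continuous_on ({0..1 / 2} \<union> {1 / 2..1}) ?F"
      by (rule continuous_on_If) (auto intro!: continuous_intros simp: power2_eq_square, algebra)
    moreover have "{0..1 / 2} \<union> {1 / 2..1} = {0..1::real}" by auto
    ultimately show "continuous_on {0..1} ?F" by simp
  qed auto
  then show ?thesis by (simp add: integral_unique)
qed

lemma admissible_factor_tent: "admissible_factor (\<lambda>x. min x (1 - x))"
  unfolding admissible_factor_def
proof (intro conjI exI)
  have "1-lipschitz_on {0..1} (\<lambda>x::real. min x (1 - x))"
    by (rule lipschitz_onI) (auto simp: dist_real_def)
  then show "absolutely_continuous_on_interval 0 1 (\<lambda>x. min x (1 - x))"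
    by (rule lipschitz_imp_absolutely_continuous_on_interval)
  \<comment> \<open>The kink at \<open>1 / 2\<close> is a null set, first for \<open>lborel\<close>,
    then for its completion restricted to the interval.\<close>
  have "AE x in lebesgue_on {0..1}. x \<noteq> (1 / 2 :: real)"
    using AE_completion[OF AE_lborel_singleton[of "1 / 2 :: real"]]
    by (subst AE_restrict_space_iff) auto
  then show "AE x in lebesgue_on {0..1}. ((\<lambda>x. min x (1 - x)) has_real_derivative
      (if x < 1 / 2 then 1 else - 1)) (at x within {0..1})"
    by eventually_elim (rule has_field_derivative_at_within[OF tent_has_real_derivative])
  show "essentially_bounded_on {0..1} (\<lambda>x. if x < 1 / 2 then 1 else - 1)"
    unfolding essentially_bounded_on_def
    by (intro conjI exI[of _ 1] measurable_restrict_space1 measurable_completion) auto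
qed auto

text \<open>The derivative of the tent is taken to be \<open>1\<close> or \<open>- 1\<close>
  everywhere, so the density takes only the values \<open>1 + a\<close> and \<open>1 - a\<close>,
  nonnegative for \<open>\<bar>a\<bar> \<le> 1\<close>.\<close>

lemma copula_tent:
  assumes "\<bar>a\<bar> \<le> 1"
  shows "copula (product_perturbation a (\<lambda>x. min x (1 - x)) (\<lambda>x. min x (1 - x)))"
proof (rule copula_product_perturbationI[where B\<^sub>1 = 1 and B\<^sub>2 = 1
      and ?d1.0 = "\<lambda>x. if x < 1 / 2 then 1 else - 1" and ?d2.0 = "\<lambda>x. if x < 1 / 2 then 1 else - 1"])
  show "0 \<le> 1 + a * (if x < 1 / 2 then 1 else - 1) * (if y < 1 / 2 then 1 else - 1)" for x y :: real
    using assms by auto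
  show "\<bar>if x < 1 / 2 then 1 else - 1 :: real\<bar> \<le> 1" for x :: real by simp
  then show "\<bar>if x < 1 / 2 then 1 else - 1 :: real\<bar> \<le> 1" for x :: real .
qed (use set_integral_tent_derivative in auto)

lemma spearman_rho_tent:
  assumes "\<bar>a\<bar> \<le> 1"
  shows "spearman_rho (product_perturbation a (\<lambda>x. min x (1 - x)) (\<lambda>x. min x (1 - x))) = 3 / 4 * a"
  using spearman_rho_product_perturbation[OF copula_tent[OF assms]]
  by (simp add: integral_tent continuous_intros)

section \<open>The bounds and their sharpness\<close>

theorem theorem2:
  shows "(\<forall>a g1 g2. admissible_factor g1 \<and> admissible_factor g2 \<and>
            copula (product_perturbation a g1 g2) \<longrightarrow>
              - 3 / 4 \<le> spearman_rho (product_perturbation a g1 g2) \<and>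
              spearman_rho (product_perturbation a g1 g2) \<le> 3 / 4) \<and>
         (\<forall>c. (\<forall>a g1 g2. admissible_factor g1 \<and> admissible_factor g2 \<and>
                 copula (product_perturbation a g1 g2) \<longrightarrow>
                   c \<le> spearman_rho (product_perturbation a g1 g2))
              \<longrightarrow> c \<le> - 3 / 4) \<and>
         (\<forall>c. (\<forall>a g1 g2. admissible_factor g1 \<and> admissible_factor g2 \<and>
                 copula (product_perturbation a g1 g2) \<longrightarrow>
                   spearman_rho (product_perturbation a g1 g2) \<le> c)
              \<longrightarrow> 3 / 4 \<le> c)"
proof (intro conjI allI impI; (elim conjE)?)
  fix a g1 g2
  assume g: "admissible_factor g1" "admissible_factor g2" and C: "copula (product_perturbation a g1 g2)"
  have "\<bar>spearman_rho (product_perturbation a g1 g2)\<bar> \<le> 3 / 4"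
    using g by (intro abs_spearman_rho_product_perturbation_le[OF C]
        absolutely_continuous_on_interval_imp_continuous_on) (auto simp: admissible_factor_def)
  then show "- 3 / 4 \<le> spearman_rho (product_perturbation a g1 g2)"
    "spearman_rho (product_perturbation a g1 g2) \<le> 3 / 4" by auto
next
  fix c
  assume "\<forall>a g1 g2. admissible_factor g1 \<and> admissible_factor g2 \<and>
    copula (product_perturbation a g1 g2) \<longrightarrow> c \<le> spearman_rho (product_perturbation a g1 g2)"
  \<comment> \<open>The tent copula with \<open>a = - 1\<close> attains the lower bound, so no
    larger \<open>c\<close> is a lower bound.\<close>
  from this[rule_format, of _ _ "- 1", OF conjI[OF admissible_factor_tent
        conjI[OF admissible_factor_tent copula_tent]]]
  show "c \<le> - 3 / 4" by (simp add: spearman_rho_tent)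
next
  fix c
  assume "\<forall>a g1 g2. admissible_factor g1 \<and> admissible_factor g2 \<and>
    copula (product_perturbation a g1 g2) \<longrightarrow> spearman_rho (product_perturbation a g1 g2) \<le> c"
  \<comment> \<open>The tent copula with \<open>a = 1\<close> attains the upper bound.\<close>
  from this[rule_format, of _ _ 1, OF conjI[OF admissible_factor_tent
        conjI[OF admissible_factor_tent copula_tent]]]
  show "3 / 4 \<le> c" by (simp add: spearman_rho_tent)
qed

end
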